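(* For every metric space $(X,d_X)$, the inverse semigroup $M(X)$ of coarse equivalence classes of metrics on the double of $X$ is fundamental; that is, for any $s,t\in M(X)$ with $s\neq t$ there exists an idempotent $e\in M(X)$ such that $ses^*\neq tet^*$.
   Context: Let $X=(X,d_X)$ be a metric space. A double of $X$ is the set $X\times\{0,1\}$ with a metric $d$ such that the restriction of $d$ to each copy $X\times\{0\}$, $X\times\{1\}$ of $X$ equals $d_X$, and the distance between the two copies is non-zero. Writing $x$ for $(x,0)$ and $x'$ for $(x,1)$, the last condition means that there exists $c>0$ with $d(x,y')\geq c$ for all $x,y\in X$. Let $\mathcal M(X)$ denote the set of all such metrics $d$; an element $d\in\mathcal M(X)$ is determined by the values $d(x,y')$, $x,y\in X$. Two metrics $d_1,d_2\in\mathcal M(X)$ are coarsely equivalent, written $d_1\sim d_2$ or $[d_1]=[d_2]$, if there exists a homeomorphism $\phi$ of $[0,\infty)$ such that $\phi^{-1}(d_1(x,y'))\leq d_2(x,y')\leq\phi(d_1(x,y'))$ for all $x,y\in X$. Set $M(X)=\mathcal M(X)/\sim$. For $d_1,d_2\in\mathcal M(X)$, the formula $(d_1d_2)(x,y')=\inf_{u\in X}[d_1(x,u')+d_2(u,y')]$, $x,y\in X$, defines a metric $d_1d_2\in\mathcal M(X)$, and the product on $M(X)$ is $[d_1][d_2]=[d_1d_2]$. It is known from earlier work that with this multiplication $M(X)$ is an inverse semigroup. A semigroup $S$ is an inverse semigroup if for every $s\in S$ there is a unique $t\in S$ (the pseudoinverse of $s$, denoted $s^*$) such that $sts=s$ and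 $tst=t$. Let $E(S)$ be the set of idempotents of $S$. Then $S$ acts on $E(S)$ by $\mu_s(e)=ses^*$, $e\in E(S)$, and $S$ is called fundamental if $\mu_s\neq\mu_t$ whenever $s\neq t$. *)

theory Defs
  imports "HOL-Analysis.Analysis"
begin

text \<open>
  The double of a metric space \<open>(M, d)\<close> has the carrier \<open>M \<times> UNIV :: ('a \<times> bool) set\<close>;
  the point \<open>x\<close> of the first copy is \<open>(x, False)\<close>, its twin \<open>x'\<close> is \<open>(x, True)\<close>.
  Metrics are total functions, and their values outside the carrier carry no meaning: two
  functions with the same values on the carrier are coarsely equivalent below, so they
  give the same element of the quotient.
\<close>

type_synonym 'a double_dist = "'a \<times> bool \<Rightarrow> 'a \<times> bool \<Rightarrow> real"

definition double_metrics :: "'a set \<Rightarrow> ('a \<Rightarrow> 'a \<Rightarrow> real) \<Rightarrow> 'a double_dist set" where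
  "double_metrics M d =
    {D. Metric_space (M \<times> UNIV) D \<and>
        (\<forall>i. \<forall>x\<in>M. \<forall>y\<in>M. D (x, i) (y, i) = d x y) \<and>
        (\<exists>c>0. \<forall>x\<in>M. \<forall>y\<in>M. c \<le> D (x, False) (y, True))}"

definition coarse_rel :: "'a set \<Rightarrow> ('a \<Rightarrow> 'a \<Rightarrow> real) \<Rightarrow> ('a double_dist \<times> 'a double_dist) set" where
  "coarse_rel M d =
    {(D1, D2). D1 \<in> double_metrics M d \<and> D2 \<in> double_metrics M d \<and>
      (\<exists>\<phi> \<psi>. homeomorphism {0..} {0..} \<phi> \<psi> \<and>
        (\<forall>x\<in>M. \<forall>y\<in>M.
          \<psi> (D1 (x, False) (y, True)) \<le> D2 (x, False) (y, True) \<and>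
          D2 (x, False) (y, True) \<le> \<phi> (D1 (x, False) (y, True))))}"

definition coarse_classes :: "'a set \<Rightarrow> ('a \<Rightarrow> 'a \<Rightarrow> real) \<Rightarrow> 'a double_dist set set" where
  "coarse_classes M d = double_metrics M d // coarse_rel M d"

text \<open>
  A metric on the double is determined by its values \<open>b x y\<close> at the pairs \<open>(x, y')\<close>. The value
  \<open>0\<close> off the carrier is needed because \<^locale>\<open>Metric_space\<close> asks for symmetry and
  nonnegativity on the whole type.
\<close>

definition double_of :: "'a set \<Rightarrow> ('a \<Rightarrow> 'a \<Rightarrow> real) \<Rightarrow> ('a \<Rightarrow> 'a \<Rightarrow> real) \<Rightarrow> 'a double_dist" where
  "double_of M d b = (\<lambda>(x, i) (y, j).
    if x \<in> M \<and> y \<in> M then (if i = j then d x y else if j then b x y else b y x) else 0)"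

definition metric_prod ::
    "'a set \<Rightarrow> ('a \<Rightarrow> 'a \<Rightarrow> real) \<Rightarrow> 'a double_dist \<Rightarrow> 'a double_dist \<Rightarrow> 'a double_dist" where
  "metric_prod M d D1 D2 =
    double_of M d (\<lambda>x y. INF u\<in>M. D1 (x, False) (u, True) + D2 (u, False) (y, True))"

definition class_prod ::
    "'a set \<Rightarrow> ('a \<Rightarrow> 'a \<Rightarrow> real) \<Rightarrow> 'a double_dist set \<Rightarrow> 'a double_dist set \<Rightarrow> 'a double_dist set" where
  "class_prod M d A B = (\<Union>D1\<in>A. \<Union>D2\<in>B. coarse_rel M d `` {metric_prod M d D1 D2})"

definition is_pseudoinverse :: "'s set \<Rightarrow> ('s \<Rightarrow> 's \<Rightarrow> 's) \<Rightarrow> 's \<Rightarrow> 's \<Rightarrow> bool" where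
  "is_pseudoinverse S m s t \<longleftrightarrow> t \<in> S \<and> m (m s t) s = s \<and> m (m t s) t = t"

definition inverse_semigroup :: "'s set \<Rightarrow> ('s \<Rightarrow> 's \<Rightarrow> 's) \<Rightarrow> bool" where
  "inverse_semigroup S m \<longleftrightarrow>
    (\<forall>a\<in>S. \<forall>b\<in>S. m a b \<in> S) \<and>
    (\<forall>a\<in>S. \<forall>b\<in>S. \<forall>c\<in>S. m (m a b) c = m a (m b c)) \<and>
    (\<forall>s\<in>S. \<exists>!t. is_pseudoinverse S m s t)"

definition pseudoinverse :: "'s set \<Rightarrow> ('s \<Rightarrow> 's \<Rightarrow> 's) \<Rightarrow> 's \<Rightarrow> 's" where
  "pseudoinverse S m s = (THE t. is_pseudoinverse S m s t)"

definition idempotents :: "'s set \<Rightarrow> ('s \<Rightarrow> 's \<Rightarrow> 's) \<Rightarrow> 's set" where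
  "idempotents S m = {e \<in> S. m e e = e}"

definition conj_action :: "'s set \<Rightarrow> ('s \<Rightarrow> 's \<Rightarrow> 's) \<Rightarrow> 's \<Rightarrow> 's \<Rightarrow> 's" where
  "conj_action S m s e = m (m s e) (pseudoinverse S m s)"

definition fundamental :: "'s set \<Rightarrow> ('s \<Rightarrow> 's \<Rightarrow> 's) \<Rightarrow> bool" where
  "fundamental S m \<longleftrightarrow>
    (\<forall>s\<in>S. \<forall>t\<in>S. s \<noteq> t \<longrightarrow>
      (\<exists>e\<in>idempotents S m. conj_action S m s e \<noteq> conj_action S m t e))"

end

theory Submission
  imports Defs
begin

text \<open>
  A metric \<open>D\<close> on the double enters only through the family of relations on which \<open>D x y'\<close> is
  bounded: coarsely equivalent means equal families, the product of metrics becomes composition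
  of relations and the pseudoinverse becomes the converse. If \<open>D\<close> is idempotent, then its
  relations are entourages of \<open>d\<close> whose domains and ranges are again measured by \<open>D\<close>; hence
  idempotents commute, which makes pseudoinverses unique.

  A subset \<open>A\<close> of \<open>M\<close> gives an idempotent, and conjugation by \<open>s\<close> moves it to the coarse image
  of \<open>A\<close> under \<open>s\<close>. Suppose that \<open>s (x n) (y n)\<close> is bounded and \<open>t (x n) (y n)\<close> is unbounded.
  If \<open>s\<close> and \<open>t\<close> act equally on the idempotent of \<open>M\<close>, then there are \<open>z n\<close> with
  \<open>t (x n) (z n)\<close> bounded, and \<open>d (y n) (z n)\<close> tends to infinity. Along a subsequence the
  distance from \<open>z k\<close> to the set \<open>A\<close> of all \<open>y j\<close> tends to infinity too, so that the idempotent
  of \<open>A\<close> separates \<open>s\<close> from \<open>t\<close>.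
\<close>

section \<open>Semigroups with commuting idempotents\<close>

text \<open>Two pseudoinverses \<open>t\<close> and \<open>u\<close> of \<open>s\<close> both equal
  \<open>tsu\<close>: insert \<open>s = sus\<close> into \<open>t = tst\<close>, or
  \<open>s = sts\<close> into \<open>u = usu\<close>, and exchange the two adjacent
  idempotents.\<close>

lemma inverse_semigroup_if_commuting_idempotents:
  assumes closed: "\<And>a b. a \<in> S \<Longrightarrow> b \<in> S \<Longrightarrow> m a b \<in> S"
    and assoc: "\<And>a b c. a \<in> S \<Longrightarrow> b \<in> S \<Longrightarrow> c \<in> S \<Longrightarrow> m (m a b) c = m a (m b c)"
    and regular: "\<And>s. s \<in> S \<Longrightarrow> \<exists>t. is_pseudoinverse S m s t"
    and commute: "\<And>e f. e \<in> idempotents S m \<Longrightarrow> f \<in> idempotents S m \<Longrightarrow> m e f = m f e"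
  shows "inverse_semigroup S m"
proof -
  have "t = u" if s: "s \<in> S" and t: "is_pseudoinverse S m s t" and u: "is_pseudoinverse S m s u" for s t u
  proof -
    have tS: "t \<in> S" "m (m s t) s = s" "m (m t s) t = t"
      using t by (auto simp: is_pseudoinverse_def)
    have uS: "u \<in> S" "m (m s u) s = s" "m (m u s) u = u"
      using u by (auto simp: is_pseudoinverse_def)
    \<comment> \<open>The laws \<open>sts = s\<close>, \<open>tst = t\<close> and their analogues
      for \<open>u\<close>, each with a right factor \<open>x\<close>, so that they rewrite inside
      longer right-nested products.\<close>
    have absorb: "m s (m t (m s x)) = m s x" "m s (m u (m s x)) = m s x"
        "m t (m s (m t x)) = m t x" "m u (m s (m u x)) = m u x" if "x \<in> S" for x
      using that s tS uS by (simp_all add: closed flip: assoc)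
    have idem: "m s t \<in> idempotents S m" "m s u \<in> idempotents S m"
        "m t s \<in> idempotents S m" "m u s \<in> idempotents S m"
      using s tS uS absorb by (simp_all add: idempotents_def closed assoc)
    have "t = m t (m (m s u) (m s t))"
      using s tS uS absorb by (simp add: closed assoc)
    also have "\<dots> = m t (m (m s t) (m s u))"
      using commute idem by simp
    also have "\<dots> = m (m t s) u"
      using s tS uS absorb by (simp add: closed assoc)
    finally have 1: "t = m (m t s) u" .
    have "u = m (m (m u s) (m t s)) u"
      using s tS uS absorb by (simp add: closed assoc)
    also have "\<dots> = m (m (m t s) (m u s)) u"
      using commute idem by simp
    also have "\<dots> = m (m t s) u"
      using s tS uS absorb by (simp add: closed assoc)
    finally show ?thesis using 1 by simp
  qed
  then have "\<exists>!t. is_pseudoinverse S m s t" if "s \<in> S" for s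
    using regular[OF that] that by (blast intro: ex_ex1I)
  then show ?thesis
    unfolding inverse_semigroup_def by (simp add: closed assoc)
qed

lemma pseudoinverse_eq:
  assumes "inverse_semigroup S m" "s \<in> S" "is_pseudoinverse S m s t"
  shows "pseudoinverse S m s = t"
  using assms unfolding inverse_semigroup_def pseudoinverse_def by (metis the_equality)

section \<open>Coarse equivalence through families of relations\<close>

text \<open>A homeomorphism of the half-line sends 0 to 0, so arbitrary bounds can be dominated only
  away from 0. Adding to the identity a ramp starting at each multiple of \<open>h\<close> gives a
  locally finite sum that is steep enough from \<open>h\<close> on.\<close>

lemma ex_homeomorphism_dominating:
  fixes S :: "nat \<Rightarrow> real"
  assumes h: "h > 0"
  obtains \<phi> \<psi> where "homeomorphism {0..} {0..} \<phi> \<psi>" "strict_mono \<phi>"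
    "\<And>r. h \<le> r \<Longrightarrow> \<exists>n. r \<le> real n * h \<and> S n \<le> \<phi> r"
proof -
  \<comment> \<open>If \<open>k * h \<le> r \<le> (k + 1) * h\<close>, then the \<open>n\<close>-th ramp is known to have reached \<open>h\<close> only for
    \<open>n < k\<close>, and it has to exceed \<open>S (k + 1)\<close>: hence the shift by 2.\<close>
  define P where "P N r = r + (\<Sum>n<N. \<bar>S (n + 2)\<bar> / h * max 0 (r - real n * h))" for N r
  define \<phi> where "\<phi> r = P (nat \<lceil>r / h\<rceil>) r" for r
  \<comment> \<open>Ramps starting at or beyond \<open>r\<close> vanish at \<open>r\<close>, so
    every long enough finite sum computes \<phi>. Monotonicity and continuity can then be read off
    from a fixed \<open>P N\<close>.\<close>
  have \<phi>_eq: "\<phi> r = P N r" if "r \<le> real N * h" for r N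
  proof -
    let ?k = "nat \<lceil>r / h\<rceil>"
    have "r / h \<le> real N" using that h by (simp add: field_simps)
    then have k: "?k \<le> N" by linarith
    have "\<bar>S (n + 2)\<bar> / h * max 0 (r - real n * h) = 0" if "n \<in> {..<N} - {..<?k}" for n
    proof -
      have "?k \<le> n" using that by simp
      then have "r / h \<le> real n" by linarith
      then show ?thesis using h by (simp add: field_simps)
    qed
    then have "(\<Sum>n<?k. \<bar>S (n + 2)\<bar> / h * max 0 (r - real n * h)) =
        (\<Sum>n<N. \<bar>S (n + 2)\<bar> / h * max 0 (r - real n * h))"
      using k by (intro sum.mono_neutral_left ballI) auto
    then show ?thesis unfolding \<phi>_def P_def by simp
  qed
  have P_mono: "P N r < P N r'" if "r < r'" for N r r'
    unfolding P_def using that h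
    by (intro add_less_le_mono sum_mono mult_left_mono) auto
  have ex_N: "\<exists>N. r < real N * h" for r
    using h by (metis reals_Archimedean3)
  have mono: "strict_mono \<phi>"
  proof (rule strict_monoI)
    fix r r' :: real assume "r < r'"
    moreover obtain N where "r' < real N * h" using ex_N by blast
    ultimately show "\<phi> r < \<phi> r'" using \<phi>_eq[of r N] \<phi>_eq[of r' N] P_mono by simp
  qed
  have "continuous_on {..<real N * h} \<phi>" for N
  proof -
    have "continuous_on {..<real N * h} (P N)"
      unfolding P_def by (intro continuous_intros)
    then show ?thesis by (rule continuous_on_eq) (use \<phi>_eq[of _ N] in force)
  qed
  then have "continuous_on (\<Union>N. {..<real N * h}) \<phi>"
    by (intro continuous_on_open_UN) auto
  moreover have "(\<Union>N. {..<real N * h}) = UNIV" using ex_N by auto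
  ultimately have cont: "continuous_on T \<phi>" for T
    using continuous_on_subset by (metis subset_UNIV)
  have zero: "\<phi> 0 = 0" using \<phi>_eq[of 0 0] by (simp add: P_def)
  have ge: "r \<le> \<phi> r" for r
    unfolding \<phi>_def P_def using h by (simp add: sum_nonneg)
  have "\<phi> ` {0..} = {0..}"
  proof
    show "\<phi> ` {0..} \<subseteq> {0..}" using ge by (auto intro: order_trans)
    show "{0..} \<subseteq> \<phi> ` {0..}"
    proof
      fix y :: real assume "y \<in> {0..}"
      then show "y \<in> \<phi> ` {0..}"
        using IVT'[of \<phi> 0 y y] zero ge[of y] cont by force
    qed
  qed
  moreover have "inj_on \<phi> {0..}"
    using mono strict_mono_imp_inj_on by blast
  ultimately obtain \<psi> where "homeomorphism {0..} {0..} \<phi> \<psi>"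
    using injective_into_1d_eq_homeomorphism[of "{0..}" \<phi>] cont
    by (metis convex_real_interval(1) convex_imp_path_connected)
  moreover have "\<exists>n. r \<le> real n * h \<and> S n \<le> \<phi> r" if r: "h \<le> r" for r
  proof -
    define k where "k = nat \<lfloor>r / h\<rfloor>"
    have "1 \<le> r / h" using r h by simp
    then have "real k \<le> r / h" "r / h \<le> real (k + 1)" "1 \<le> k" unfolding k_def by linarith+
    then have k: "real k * h \<le> r" "r \<le> real (k + 1) * h" "1 \<le> k" using h
      by (auto simp: field_simps)
    then obtain l where l: "k = Suc l" by (cases k) auto
    have "S (k + 1) \<le> \<bar>S (l + 2)\<bar> / h * h" using h l by simp
    also have "\<dots> \<le> \<bar>S (l + 2)\<bar> / h * max 0 (r - real l * h)"
      using h k l by (intro mult_left_mono) (auto simp: algebra_simps)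
    also have "\<dots> \<le> (\<Sum>n<k+1. \<bar>S (n + 2)\<bar> / h * max 0 (r - real n * h))"
      using h l by (intro member_le_sum) auto
    also have "\<dots> \<le> P (k + 1) r" using r h by (simp add: P_def)
    finally show ?thesis using k \<phi>_eq[of r "k + 1"] by metis
  qed
  ultimately show ?thesis using that mono by blast
qed

section \<open>Families of bounded relations and their products\<close>

definition controlled :: "'a set \<Rightarrow> ('a \<Rightarrow> 'a \<Rightarrow> real) \<Rightarrow> 'a rel set" where
  "controlled M b = {A. A \<subseteq> M \<times> M \<and> (\<exists>R. \<forall>(x, y)\<in>A. b x y \<le> R)}"

definition ideal_prod :: "'a rel set \<Rightarrow> 'a rel set \<Rightarrow> 'a rel set" where
  "ideal_prod I J = {A. \<exists>B\<in>I. \<exists>C\<in>J. A \<subseteq> B O C}"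

definition cross :: "'a double_dist \<Rightarrow> 'a \<Rightarrow> 'a \<Rightarrow> real" where
  "cross D x y = D (x, False) (y, True)"

lemma controlledI:
  "A \<subseteq> M \<times> M \<Longrightarrow> (\<And>x y. (x, y) \<in> A \<Longrightarrow> b x y \<le> R) \<Longrightarrow> A \<in> controlled M b"
  unfolding controlled_def by blast

lemma controlledE:
  assumes "A \<in> controlled M b"
  obtains R where "A \<subseteq> M \<times> M" "\<And>x y. (x, y) \<in> A \<Longrightarrow> b x y \<le> R"
  using assms unfolding controlled_def by blast

lemma controlled_subset: "A \<in> controlled M b \<Longrightarrow> B \<subseteq> A \<Longrightarrow> B \<in> controlled M b"
  unfolding controlled_def by blast

lemma controlled_flip: "controlled M (\<lambda>x y. b y x) = converse ` controlled M b"
proof -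
  have *: "A\<inverse> \<in> controlled M b" if "A \<in> controlled M (\<lambda>x y. b y x)"
    for A and b :: "'a \<Rightarrow> 'a \<Rightarrow> real"
  proof -
    obtain R where "A \<subseteq> M \<times> M" "\<And>x y. (x, y) \<in> A \<Longrightarrow> b y x \<le> R"
      using \<open>A \<in> _\<close> unfolding controlled_def by blast
    then show ?thesis by (intro controlledI[where R = R]) auto
  qed
  show ?thesis
  proof
    show "controlled M (\<lambda>x y. b y x) \<subseteq> converse ` controlled M b"
      using * by (metis converse_converse image_eqI subsetI)
    show "converse ` controlled M b \<subseteq> controlled M (\<lambda>x y. b y x)"
      using *[of _ "\<lambda>x y. b y x"] by auto
  qed
qed

lemma ideal_prodI: "B \<in> I \<Longrightarrow> C \<in> J \<Longrightarrow> A \<subseteq> B O C \<Longrightarrow> A \<in> ideal_prod I J"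
  unfolding ideal_prod_def by blast

lemma ideal_prodE:
  assumes "A \<in> ideal_prod I J"
  obtains B C where "B \<in> I" "C \<in> J" "A \<subseteq> B O C"
  using assms unfolding ideal_prod_def by blast

lemma ideal_prod_assoc: "ideal_prod (ideal_prod I J) K = ideal_prod I (ideal_prod J K)"
proof
  show "ideal_prod (ideal_prod I J) K \<subseteq> ideal_prod I (ideal_prod J K)"
  proof
    fix A assume "A \<in> ideal_prod (ideal_prod I J) K"
    then obtain P D where D: "P \<in> ideal_prod I J" "D \<in> K" "A \<subseteq> P O D" by (rule ideal_prodE)
    obtain B C where BC: "B \<in> I" "C \<in> J" "P \<subseteq> B O C" using D(1) by (rule ideal_prodE)
    have "C O D \<in> ideal_prod J K" using BC D by (blast intro: ideal_prodI)
    then show "A \<in> ideal_prod I (ideal_prod J K)"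
      by (rule ideal_prodI[OF BC(1)]) (use BC D in blast)
  qed
  show "ideal_prod I (ideal_prod J K) \<subseteq> ideal_prod (ideal_prod I J) K"
  proof
    fix A assume "A \<in> ideal_prod I (ideal_prod J K)"
    then obtain B P where B: "B \<in> I" "P \<in> ideal_prod J K" "A \<subseteq> B O P" by (rule ideal_prodE)
    obtain C D where CD: "C \<in> J" "D \<in> K" "P \<subseteq> C O D" using B(2) by (rule ideal_prodE)
    have "B O C \<in> ideal_prod I J" using B CD by (blast intro: ideal_prodI)
    then show "A \<in> ideal_prod (ideal_prod I J) K"
      by (rule ideal_prodI[OF _ CD(2)]) (use B CD in blast)
  qed
qed

lemma ideal_prod3E:
  assumes "A \<in> ideal_prod (ideal_prod I J) K"
  obtains B C D where "B \<in> I" "C \<in> J" "D \<in> K" "A \<subseteq> B O C O D"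
proof -
  obtain B P where B: "B \<in> I" "P \<in> ideal_prod J K" "A \<subseteq> B O P"
    using assms unfolding ideal_prod_assoc by (rule ideal_prodE)
  obtain C D where CD: "C \<in> J" "D \<in> K" "P \<subseteq> C O D" using B(2) by (rule ideal_prodE)
  show thesis by (rule that[OF B(1) CD(1,2)]) (use B CD in blast)
qed

text \<open>The sublevel sets of \<open>b1\<close> are controlled, and every controlled relation
  lies in one of them, so only they have to be tested.\<close>

lemma controlled_subset_iff:
  "controlled M b1 \<subseteq> controlled M b2 \<longleftrightarrow>
    (\<forall>R. \<exists>S. \<forall>x\<in>M. \<forall>y\<in>M. b1 x y \<le> R \<longrightarrow> b2 x y \<le> S)"
proof
  assume sub: "controlled M b1 \<subseteq> controlled M b2"
  show "\<forall>R. \<exists>S. \<forall>x\<in>M. \<forall>y\<in>M. b1 x y \<le> R \<longrightarrow> b2 x y \<le> S"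
  proof
    fix R
    have "{(x, y) \<in> M \<times> M. b1 x y \<le> R} \<in> controlled M b1"
      by (rule controlledI) auto
    with sub have "{(x, y) \<in> M \<times> M. b1 x y \<le> R} \<in> controlled M b2" by blast
    then show "\<exists>S. \<forall>x\<in>M. \<forall>y\<in>M. b1 x y \<le> R \<longrightarrow> b2 x y \<le> S"
      by (rule controlledE) blast
  qed
next
  assume *: "\<forall>R. \<exists>S. \<forall>x\<in>M. \<forall>y\<in>M. b1 x y \<le> R \<longrightarrow> b2 x y \<le> S"
  show "controlled M b1 \<subseteq> controlled M b2"
  proof
    fix A assume "A \<in> controlled M b1"
    then obtain R where R: "A \<subseteq> M \<times> M" "\<And>x y. (x, y) \<in> A \<Longrightarrow> b1 x y \<le> R"
      unfolding controlled_def by blast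
    from * obtain S where "\<forall>x\<in>M. \<forall>y\<in>M. b1 x y \<le> R \<longrightarrow> b2 x y \<le> S" by blast
    with R show "A \<in> controlled M b2" by (intro controlledI[where R = S]) auto
  qed
qed

lemma controlled_cong:
  "(\<And>x y. x \<in> M \<Longrightarrow> y \<in> M \<Longrightarrow> b x y = b' x y) \<Longrightarrow> controlled M b = controlled M b'"
  by (auto simp: set_eq_subset controlled_subset_iff)

text \<open>A homeomorphism is bounded on compact intervals, so it transfers boundedness.
  Conversely, equal families give bounds at the levels \<open>n * h\<close>, which a single
  homeomorphism dominates.\<close>

lemma coarse_rel_iff:
  assumes D1: "D1 \<in> double_metrics M d" and D2: "D2 \<in> double_metrics M d"
  shows "(D1, D2) \<in> coarse_rel M d \<longleftrightarrow> controlled M (cross D1) = controlled M (cross D2)"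
proof -
  obtain c1 where c1: "c1 > 0" "\<And>x y. x \<in> M \<Longrightarrow> y \<in> M \<Longrightarrow> c1 \<le> cross D1 x y"
    using D1 unfolding double_metrics_def cross_def by blast
  obtain c2 where c2: "c2 > 0" "\<And>x y. x \<in> M \<Longrightarrow> y \<in> M \<Longrightarrow> c2 \<le> cross D2 x y"
    using D2 unfolding double_metrics_def cross_def by blast
  show ?thesis
  proof
    assume "(D1, D2) \<in> coarse_rel M d"
    then obtain \<phi> \<psi> where hom: "homeomorphism {0::real..} {0..} \<phi> \<psi>"
      and le: "\<And>x y. x \<in> M \<Longrightarrow> y \<in> M \<Longrightarrow> \<psi> (cross D1 x y) \<le> cross D2 x y \<and> cross D2 x y \<le> \<phi> (cross D1 x y)"
      unfolding coarse_rel_def cross_def by blast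
    have bd: "\<exists>S. \<forall>r. 0 \<le> r \<and> r \<le> R \<longrightarrow> \<phi> r \<le> S" for R
    proof -
      have "continuous_on {0..R} \<phi>"
        using hom by (auto simp: homeomorphism_def elim: continuous_on_subset)
      then have "bounded (\<phi> ` {0..R})"
        using compact_continuous_image compact_imp_bounded by blast
      then show ?thesis unfolding bounded_real by (metis abs_le_D1 atLeastAtMost_iff imageI)
    qed
    have "controlled M (cross D1) \<subseteq> controlled M (cross D2)"
      unfolding controlled_subset_iff
    proof
      fix R
      obtain S where "\<forall>r. 0 \<le> r \<and> r \<le> R \<longrightarrow> \<phi> r \<le> S" using bd by blast
      then show "\<exists>S. \<forall>x\<in>M. \<forall>y\<in>M. cross D1 x y \<le> R \<longrightarrow> cross D2 x y \<le> S"
        using le c1 by (metis less_eq_real_def order_trans)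
    qed
    moreover have "controlled M (cross D2) \<subseteq> controlled M (cross D1)"
      unfolding controlled_subset_iff
    proof
      fix R
      obtain S where S: "\<forall>r. 0 \<le> r \<and> r \<le> R \<longrightarrow> \<phi> r \<le> S" using bd by blast
      \<comment> \<open>Here \<open>cross D1 x y\<close> is the image under \<phi> of
        \<open>\<psi> (cross D1 x y)\<close>, a point of the interval from 0 to \<open>R\<close>,
        where \<phi> is bounded by \<open>S\<close>.\<close>
      have "cross D1 x y \<le> S" if "x \<in> M" "y \<in> M" "cross D2 x y \<le> R" for x y
      proof -
        have 0: "cross D1 x y \<in> {0..}" using c1(2)[of x y] c1(1) that by simp
        then have "\<psi> (cross D1 x y) \<in> {0..}" "\<phi> (\<psi> (cross D1 x y)) = cross D1 x y"
          using hom unfolding homeomorphism_def by blast+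
        then show ?thesis using S le[of x y] that by (metis atLeast_iff order_trans)
      qed
      then show "\<exists>S. \<forall>x\<in>M. \<forall>y\<in>M. cross D2 x y \<le> R \<longrightarrow> cross D1 x y \<le> S" by blast
    qed
    ultimately show "controlled M (cross D1) = controlled M (cross D2)" by simp
  next
    assume eq: "controlled M (cross D1) = controlled M (cross D2)"
    \<comment> \<open>Both metrics take only values at least \<open>h\<close> between the copies, so
      domination from \<open>h\<close> on suffices.\<close>
    define h where "h = min c1 c2"
    have h: "h > 0" using c1 c2 by (simp add: h_def)
    have "\<forall>n::nat. \<exists>S. \<forall>x\<in>M. \<forall>y\<in>M. cross D1 x y \<le> real n * h \<longrightarrow> cross D2 x y \<le> S"
      using eq controlled_subset_iff[of M "cross D1" "cross D2"] by auto
    then obtain S1 where S1: "\<And>n x y. x \<in> M \<Longrightarrow> y \<in> M \<Longrightarrow> cross D1 x y \<le> real n * h \<Longrightarrow> cross D2 x y \<le> S1 n"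
      by metis
    have "\<forall>n::nat. \<exists>S. \<forall>x\<in>M. \<forall>y\<in>M. cross D2 x y \<le> real n * h \<longrightarrow> cross D1 x y \<le> S"
      using eq controlled_subset_iff[of M "cross D2" "cross D1"] by auto
    then obtain S2 where S2: "\<And>n x y. x \<in> M \<Longrightarrow> y \<in> M \<Longrightarrow> cross D2 x y \<le> real n * h \<Longrightarrow> cross D1 x y \<le> S2 n"
      by metis
    \<comment> \<open>The maximum lets one \<phi> serve both directions; the lower estimate follows
      by applying \<phi> to it.\<close>
    obtain \<phi> \<psi> where hom: "homeomorphism {0..} {0..} \<phi> \<psi>" and mono: "strict_mono \<phi>"
      and dom: "\<And>r. h \<le> r \<Longrightarrow> \<exists>n. r \<le> real n * h \<and> max (S1 n) (S2 n) \<le> \<phi> r"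
      using ex_homeomorphism_dominating[OF h, of "\<lambda>n. max (S1 n) (S2 n)"] by blast
    have "\<psi> (cross D1 x y) \<le> cross D2 x y \<and> cross D2 x y \<le> \<phi> (cross D1 x y)"
      if xy: "x \<in> M" "y \<in> M" for x y
    proof
      have h1: "h \<le> cross D1 x y" and h2: "h \<le> cross D2 x y"
        using c1(2)[OF xy] c2(2)[OF xy] by (auto simp: h_def)
      show "cross D2 x y \<le> \<phi> (cross D1 x y)"
        using dom[OF h1] S1[OF xy] by force
      have "\<phi> (\<psi> (cross D1 x y)) = cross D1 x y"
        using hom h h1 by (auto simp: homeomorphism_def)
      also have "\<dots> \<le> \<phi> (cross D2 x y)"
        using dom[OF h2] S2[OF xy] by force
      finally show "\<psi> (cross D1 x y) \<le> cross D2 x y"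
        using mono by (simp add: strict_mono_less_eq)
    qed
    then show "(D1, D2) \<in> coarse_rel M d"
      unfolding coarse_rel_def cross_def using D1 D2 hom by blast
  qed
qed

section \<open>Gluings\<close>

context Metric_space
begin

text \<open>The conditions on \<open>b x y = D x y'\<close> under which \<open>b\<close> extends \<open>d\<close> to a metric on the double
  (when \<open>c > 0\<close>). Admitting \<open>c = 0\<close> makes \<open>d\<close> itself an instance.\<close>

definition gluing :: "real \<Rightarrow> ('a \<Rightarrow> 'a \<Rightarrow> real) \<Rightarrow> bool" where
  "gluing c b \<longleftrightarrow>
    (\<forall>x\<in>M. \<forall>y\<in>M. c \<le> b x y) \<and>
    (\<forall>x\<in>M. \<forall>y\<in>M. \<forall>z\<in>M. b x z \<le> d x y + b y z \<and> b x z \<le> b x y + d y z \<and>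
      d x z \<le> b x y + b z y \<and> d x z \<le> b y x + b y z)"

lemma gluingD:
  assumes "gluing c b" "x \<in> M" "y \<in> M"
  shows "c \<le> b x y"
    "z \<in> M \<Longrightarrow> b x z \<le> d x y + b y z" "z \<in> M \<Longrightarrow> b x z \<le> b x y + d y z"
    "z \<in> M \<Longrightarrow> d x z \<le> b x y + b z y" "z \<in> M \<Longrightarrow> d x z \<le> b y x + b y z"
  using assms unfolding gluing_def by blast+

lemma gluing_metric: "gluing 0 d"
  unfolding gluing_def using triangle commute nonneg by metis

lemma gluing_flip: "gluing c b \<Longrightarrow> gluing c (\<lambda>x y. b y x)"
  unfolding gluing_def by (metis add.commute commute)

lemma gluing_add: "gluing c b \<Longrightarrow> 0 \<le> k \<Longrightarrow> gluing (c + k) (\<lambda>x y. b x y + k)"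
  unfolding gluing_def by (smt (verit))

lemma gluing_cross:
  assumes "D \<in> double_metrics M d"
  obtains c where "c > 0" "gluing c (cross D)"
proof -
  obtain c where c: "c > 0" "\<forall>x\<in>M. \<forall>y\<in>M. c \<le> D (x, False) (y, True)"
    using assms by (auto simp: double_metrics_def)
  interpret D: Metric_space "M \<times> UNIV" D
    using assms by (auto simp: double_metrics_def)
  have eq: "\<And>i x y. x \<in> M \<Longrightarrow> y \<in> M \<Longrightarrow> D (x, i) (y, i) = d x y"
    using assms by (auto simp: double_metrics_def)
  have "gluing c (cross D)"
    unfolding gluing_def cross_def
  proof (intro conjI ballI)
    fix x y assume "x \<in> M" "y \<in> M"
    then show "c \<le> D (x, False) (y, True)" using c by blast
  next
    fix x y z assume xyz: "x \<in> M" "y \<in> M" "z \<in> M"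
    then show "D (x, False) (z, True) \<le> d x y + D (y, False) (z, True)"
      using D.triangle[of "(x, False)" "(y, False)" "(z, True)"] eq by simp
    show "D (x, False) (z, True) \<le> D (x, False) (y, True) + d y z"
      using D.triangle[of "(x, False)" "(y, True)" "(z, True)"] eq xyz by simp
    show "d x z \<le> D (x, False) (y, True) + D (z, False) (y, True)"
      using D.triangle[of "(x, False)" "(y, True)" "(z, False)"] eq xyz
        D.commute[of "(z, False)"] by simp
    show "d x z \<le> D (y, False) (x, True) + D (y, False) (z, True)"
      using D.triangle[of "(x, True)" "(y, False)" "(z, True)"] eq xyz
        D.commute[of "(x, True)" "(y, False)"] by simp
  qed
  with c that show ?thesis by blast
qed

lemma cross_double_of: "x \<in> M \<Longrightarrow> y \<in> M \<Longrightarrow> cross (double_of M d b) x y = b x y"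
  by (simp add: cross_def double_of_def)

lemma controlled_double_of: "controlled M (cross (double_of M d b)) = controlled M b"
  by (rule controlled_cong) (rule cross_double_of)

lemma double_of_double_metrics:
  assumes c: "c > 0" and b: "gluing c b"
  shows "double_of M d b \<in> double_metrics M d"
proof -
  let ?D = "double_of M d b"
  have pos: "x \<in> M \<Longrightarrow> y \<in> M \<Longrightarrow> 0 < b x y" for x y
    using gluingD(1)[OF b] c by fastforce
  have "Metric_space (M \<times> UNIV) ?D"
  proof
    fix p q :: "'a \<times> bool"
    show "0 \<le> ?D p q"
      using pos by (auto simp: double_of_def less_imp_le split: prod.splits)
    show "?D p q = ?D q p"
      using commute by (auto simp: double_of_def split: prod.splits)
    assume "p \<in> M \<times> UNIV" "q \<in> M \<times> UNIV"
    then show "(?D p q = 0) = (p = q)"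
      using pos zero by (force simp: double_of_def split: prod.splits if_splits)
  next
    fix p q r :: "'a \<times> bool"
    assume "p \<in> M \<times> UNIV" "q \<in> M \<times> UNIV" "r \<in> M \<times> UNIV"
    then obtain x i y j z k where "p = (x, i)" "q = (y, j)" "r = (z, k)"
      and xyz: "x \<in> M" "y \<in> M" "z \<in> M" by auto
    \<comment> \<open>Eight cases for the copies containing the three points. Exchanging the copies
      reverses the arguments of \<open>b\<close>, hence the instances for \<open>z y x\<close> as
      well.\<close>
    then show "?D p r \<le> ?D p q + ?D q r"
      using triangle[of x y z] gluingD(2-5)[OF b, of x y z] gluingD(2-5)[OF b, of z y x]
        commute
      by (cases i; cases j; cases k) (simp_all add: double_of_def add.commute)
  qed
  then show ?thesis
    unfolding double_metrics_def using c gluingD(1)[OF b] by (auto simp: double_of_def)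
qed

text \<open>Paths between the copies are made to pass through \<open>A\<close>. The choice
  \<open>A = M\<close> yields the product of metrics, while \<open>b1 = d\<close> and
  \<open>b2 = d + 1\<close> yield the idempotent of \<open>A\<close>. The second condition on
  \<open>A\<close> keeps the infimum over a nonempty set whenever \<open>M\<close> has
  points.\<close>

lemma
  assumes b1: "gluing c1 b1" and b2: "gluing c2 b2" and c: "0 \<le> c1" "0 \<le> c2"
    and A: "A \<subseteq> M" "A = {} \<Longrightarrow> M = {}"
  defines "b \<equiv> \<lambda>x y. INF u\<in>A. b1 x u + b2 u y"
  shows gluing_INF: "gluing (c1 + c2) b"
    and controlled_INF: "G \<in> controlled M b \<longleftrightarrow>
      (\<exists>B\<in>controlled M b1. \<exists>C\<in>controlled M b2. G \<subseteq> B O Id_on A O C)"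
proof -
  have nn: "c1 \<le> b1 x u" "c2 \<le> b2 u y" if "x \<in> M" "y \<in> M" "u \<in> A" for x y u
    using gluingD(1)[OF b1] gluingD(1)[OF b2] that A by blast+
  have ne: "A \<noteq> {}" if "x \<in> M" for x using that A by blast
  have lower: "b x y \<le> b1 x u + b2 u y" if "x \<in> M" "y \<in> M" "u \<in> A" for x y u
    unfolding b_def
  proof (rule cINF_lower)
    show "bdd_below ((\<lambda>u. b1 x u + b2 u y) ` A)"
      by (rule bdd_belowI2[where m = "c1 + c2"]) (use nn that in \<open>simp add: add_mono\<close>)
  qed fact
  have approx: "\<exists>u\<in>A. b1 x u + b2 u y < r" if "x \<in> M" "y \<in> M" "b x y < r" for x y r
    using cInf_lessD[of "(\<lambda>u. b1 x u + b2 u y) ` A" r] ne that unfolding b_def by auto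
  \<comment> \<open>The summand \<open>l\<close> allows two infima to be estimated one after the
    other.\<close>
  have greatest: "k \<le> l + b x y" if xy: "x \<in> M" "y \<in> M" and le: "\<And>u. u \<in> A \<Longrightarrow> k \<le> l + (b1 x u + b2 u y)" for k l x y
  proof (rule ccontr)
    assume "\<not> k \<le> l + b x y"
    then obtain u where "u \<in> A" "b1 x u + b2 u y < k - l"
      using approx[OF xy, of "k - l"] by auto
    then show False using le[of u] by simp
  qed
  show "gluing (c1 + c2) b"
    unfolding gluing_def
  proof (intro conjI ballI)
    fix x y assume xy: "x \<in> M" "y \<in> M"
    show "c1 + c2 \<le> b x y"
      using greatest[of x y "c1 + c2" 0] nn xy by (simp add: add_mono)
  next
    fix x y z assume xyz: "x \<in> M" "y \<in> M" "z \<in> M"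
    show "b x z \<le> d x y + b y z"
    proof (rule greatest)
      fix u assume u: "u \<in> A"
      then show "b x z \<le> d x y + (b1 y u + b2 u z)"
        using lower[of x z u] gluingD(2)[OF b1, of x y u] xyz A by fastforce
    qed (use xyz in auto)
    show "b x z \<le> b x y + d y z"
      unfolding add.commute[of "b x y"]
    proof (rule greatest)
      fix u assume u: "u \<in> A"
      then show "b x z \<le> d y z + (b1 x u + b2 u y)"
        using lower[of x z u] gluingD(3)[OF b2, of u y z] xyz A by fastforce
    qed (use xyz in auto)
    show "d x z \<le> b x y + b z y"
    proof (intro greatest)
      fix v assume v: "v \<in> A"
      have "d x z \<le> b1 z v + b2 v y + b x y"
      proof (rule greatest)
        fix u assume u: "u \<in> A"
        have "u \<in> M" "v \<in> M" using u v A by auto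
        \<comment> \<open>Compare both midpoints: \<open>d x z \<le> b1 x u + b1 z u\<close>, then
          \<open>b1 z u \<le> b1 z v + d v u\<close>, and finally
          \<open>d v u \<le> b2 v y + b2 u y\<close>.\<close>
        then show "d x z \<le> b1 z v + b2 v y + (b1 x u + b2 u y)"
          using gluingD(4)[OF b1, of x u z] gluingD(3)[OF b1, of z v u]
            gluingD(4)[OF b2, of v y u] xyz by simp
      qed (use xyz in auto)
      then show "d x z \<le> b x y + (b1 z v + b2 v y)" by simp
    qed (use xyz in auto)
    show "d x z \<le> b y x + b y z"
    proof (intro greatest)
      fix v assume v: "v \<in> A"
      have "d x z \<le> b1 y v + b2 v z + b y x"
      proof (rule greatest)
        fix u assume u: "u \<in> A"
        have "u \<in> M" "v \<in> M" using u v A by auto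
        then show "d x z \<le> b1 y v + b2 v z + (b1 y u + b2 u x)"
          using gluingD(5)[OF b2, of x u z] gluingD(2)[OF b2, of u v z]
            gluingD(5)[OF b1, of u y v] xyz by simp
      qed (use xyz in auto)
      then show "d x z \<le> b y x + (b1 y v + b2 v z)" by simp
    qed (use xyz in auto)
  qed
  show "G \<in> controlled M b \<longleftrightarrow>
      (\<exists>B\<in>controlled M b1. \<exists>C\<in>controlled M b2. G \<subseteq> B O Id_on A O C)"
  proof
    assume "G \<in> controlled M b"
    then obtain R where R: "G \<subseteq> M \<times> M" "\<And>x y. (x, y) \<in> G \<Longrightarrow> b x y \<le> R"
      unfolding controlled_def by blast
    \<comment> \<open>The infimum need not be attained, hence \<open>R + 1\<close>. Since both
      summands are nonnegative, each of them is bounded by their sum.\<close>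
    define B where "B = {(x, u) \<in> M \<times> M. b1 x u \<le> R + 1}"
    define C where "C = {(u, y) \<in> M \<times> M. b2 u y \<le> R + 1}"
    have "(x, y) \<in> B O Id_on A O C" if "(x, y) \<in> G" for x y
    proof -
      have xy: "x \<in> M" "y \<in> M" "b x y < R + 1" using that R by fastforce+
      then obtain u where u: "u \<in> A" "b1 x u + b2 u y < R + 1" using approx by blast
      then have "(x, u) \<in> B" "(u, y) \<in> C"
        using nn[of x y u] xy A c by (auto simp: B_def C_def)
      then show ?thesis using u by auto
    qed
    then have "G \<subseteq> B O Id_on A O C" by auto
    moreover have "B \<in> controlled M b1" "C \<in> controlled M b2"
      unfolding B_def C_def by (rule controlledI, auto)+
    ultimately show "\<exists>B\<in>controlled M b1. \<exists>C\<in>controlled M b2. G \<subseteq> B O Id_on A O C"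
      by blast
  next
    assume "\<exists>B\<in>controlled M b1. \<exists>C\<in>controlled M b2. G \<subseteq> B O Id_on A O C"
    then obtain B C where BC: "B \<in> controlled M b1" "C \<in> controlled M b2"
      and G: "G \<subseteq> B O Id_on A O C" by blast
    obtain R1 where R1: "B \<subseteq> M \<times> M" "\<And>x y. (x, y) \<in> B \<Longrightarrow> b1 x y \<le> R1"
      using BC(1) unfolding controlled_def by blast
    obtain R2 where R2: "C \<subseteq> M \<times> M" "\<And>x y. (x, y) \<in> C \<Longrightarrow> b2 x y \<le> R2"
      using BC(2) unfolding controlled_def by blast
    show "G \<in> controlled M b"
    proof (rule controlledI[where R = "R1 + R2"])
      show "G \<subseteq> M \<times> M" using G R1 R2 by blast
      fix x y assume "(x, y) \<in> G"
      then obtain u where u: "(x, u) \<in> B" "u \<in> A" "(u, y) \<in> C" using G by auto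
      then have "b x y \<le> b1 x u + b2 u y" using lower R1(1) R2(1) by blast
      then show "b x y \<le> R1 + R2" using R1(2)[OF u(1)] R2(2)[OF u(3)] by simp
    qed
  qed
qed

lemma
  assumes D1: "D1 \<in> double_metrics M d" and D2: "D2 \<in> double_metrics M d"
  shows metric_prod_double_metrics: "metric_prod M d D1 D2 \<in> double_metrics M d"
    and controlled_metric_prod: "controlled M (cross (metric_prod M d D1 D2)) =
      ideal_prod (controlled M (cross D1)) (controlled M (cross D2))"
proof -
  obtain c1 where c1: "c1 > 0" "gluing c1 (cross D1)" using D1 by (rule gluing_cross)
  obtain c2 where c2: "c2 > 0" "gluing c2 (cross D2)" using D2 by (rule gluing_cross)
  have eq: "metric_prod M d D1 D2 = double_of M d (\<lambda>x y. INF u\<in>M. cross D1 x u + cross D2 u y)"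
    by (simp add: metric_prod_def cross_def)
  show "metric_prod M d D1 D2 \<in> double_metrics M d"
    unfolding eq using c1 c2
    by (intro double_of_double_metrics[where c = "c1 + c2"] gluing_INF) auto
  show "controlled M (cross (metric_prod M d D1 D2)) =
      ideal_prod (controlled M (cross D1)) (controlled M (cross D2))" (is "?L = ?R")
  proof (rule set_eqI)
    fix G
    have comp: "B O Id_on M O C = B O C" if "B \<in> controlled M (cross D1)" for B C
      using that by (elim controlledE) auto
    have "G \<in> ?L \<longleftrightarrow> (\<exists>B\<in>controlled M (cross D1). \<exists>C\<in>controlled M (cross D2). G \<subseteq> B O Id_on M O C)"
      unfolding eq controlled_double_of using c1 c2 by (intro controlled_INF) auto
    also have "\<dots> \<longleftrightarrow> G \<in> ?R" by (simp add: ideal_prod_def comp cong: bex_cong)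
    finally show "G \<in> ?L \<longleftrightarrow> G \<in> ?R" .
  qed
qed

section \<open>The bounded coarse structure of \<open>d\<close> and its action on bounded
  relations\<close>

abbreviation entourages :: "'a rel set" where
  "entourages \<equiv> controlled M d"

lemma controlled_comp:
  assumes "gluing c b" and A: "A \<in> controlled M b" and B: "B \<in> entourages"
  shows "A O B \<in> controlled M b" "B O A \<in> controlled M b"
proof -
  obtain R where R: "A \<subseteq> M \<times> M" "\<And>x y. (x, y) \<in> A \<Longrightarrow> b x y \<le> R"
    using A unfolding controlled_def by blast
  obtain S where S: "B \<subseteq> M \<times> M" "\<And>x y. (x, y) \<in> B \<Longrightarrow> d x y \<le> S"
    using B unfolding controlled_def by blast
  show "A O B \<in> controlled M b"
  proof (rule controlledI[where R = "R + S"])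
    fix x z assume "(x, z) \<in> A O B"
    then obtain y where y: "(x, y) \<in> A" "(y, z) \<in> B" by auto
    then have "x \<in> M" "y \<in> M" "z \<in> M" using R S by auto
    then show "b x z \<le> R + S"
      using gluingD(3)[OF assms(1), of x y z] R(2)[OF y(1)] S(2)[OF y(2)] by simp
  qed (use R S in auto)
  show "B O A \<in> controlled M b"
  proof (rule controlledI[where R = "S + R"])
    fix x z assume "(x, z) \<in> B O A"
    then obtain y where y: "(x, y) \<in> B" "(y, z) \<in> A" by auto
    then have "x \<in> M" "y \<in> M" "z \<in> M" using R S by auto
    then show "b x z \<le> S + R"
      using gluingD(2)[OF assms(1), of x y z] S(2)[OF y(1)] R(2)[OF y(2)] by simp
  qed (use R S in auto)
qed

text \<open>Two points of one copy that are both near the same point of the other copy are near each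
  other.\<close>

lemma controlled_comp_converse:
  assumes b: "gluing c b" and A: "A \<in> controlled M b" and B: "B \<in> controlled M b"
  shows "A O B\<inverse> \<in> entourages" "A\<inverse> O B \<in> entourages"
proof -
  obtain R where R: "A \<subseteq> M \<times> M" "\<And>x y. (x, y) \<in> A \<Longrightarrow> b x y \<le> R"
    using A unfolding controlled_def by blast
  obtain S where S: "B \<subseteq> M \<times> M" "\<And>x y. (x, y) \<in> B \<Longrightarrow> b x y \<le> S"
    using B unfolding controlled_def by blast
  show "A O B\<inverse> \<in> entourages"
  proof (rule controlledI[where R = "R + S"])
    fix x z assume "(x, z) \<in> A O B\<inverse>"
    then obtain y where y: "(x, y) \<in> A" "(z, y) \<in> B" by auto
    then have "x \<in> M" "y \<in> M" "z \<in> M" using R S by auto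
    then show "d x z \<le> R + S"
      using gluingD(4)[OF b, of x y z] R(2)[OF y(1)] S(2)[OF y(2)] by simp
  qed (use R S in auto)
  show "A\<inverse> O B \<in> entourages"
  proof (rule controlledI[where R = "R + S"])
    fix x z assume "(x, z) \<in> A\<inverse> O B"
    then obtain y where y: "(y, x) \<in> A" "(y, z) \<in> B" by auto
    then have "x \<in> M" "y \<in> M" "z \<in> M" using R S by auto
    then show "d x z \<le> R + S"
      using gluingD(5)[OF b, of x y z] R(2)[OF y(1)] S(2)[OF y(2)] by simp
  qed (use R S in auto)
qed

text \<open>A relation followed by a converse is an entourage, which the last factor absorbs. The
  other inclusion is \<open>A \<subseteq> A O converse A O A\<close>.\<close>

lemma controlled_regular:
  assumes "gluing c b"
  shows "ideal_prod (ideal_prod (controlled M b) (converse ` controlled M b)) (controlled M b) =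
    controlled M b" (is "?L = ?R")
proof
  show "?L \<subseteq> ?R"
  proof
    fix A assume "A \<in> ?L"
    then obtain B C' D where A: "B \<in> ?R" "C' \<in> converse ` ?R" "D \<in> ?R" "A \<subseteq> B O C' O D"
      by (rule ideal_prod3E)
    obtain C where C: "C \<in> ?R" "C' = C\<inverse>" using A(2) by blast
    have "(B O C\<inverse>) O D \<in> ?R"
      using controlled_comp(2)[OF assms A(3)] controlled_comp_converse(1)[OF assms A(1) C(1)] .
    then show "A \<in> ?R" using A(4) unfolding C(2) O_assoc by (rule controlled_subset)
  qed
  show "?R \<subseteq> ?L"
  proof
    fix A assume "A \<in> ?R"
    then have "A O A\<inverse> \<in> ideal_prod ?R (converse ` ?R)" by (blast intro: ideal_prodI)
    moreover have "A \<subseteq> (A O A\<inverse>) O A" by (rule subrelI) (meson converseI relcompI)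
    ultimately show "A \<in> ?L" using \<open>A \<in> ?R\<close> by (blast intro: ideal_prodI)
  qed
qed

text \<open>Idempotency factors \<open>A\<close> through \<open>B O C\<close>. Returning from the
  end of such a path along the converse of \<open>A\<close> gives a bounded loop at its starting
  point, so the diagonal over the domain is controlled; the range is symmetric.\<close>

lemma idempotent_controlled:
  assumes b: "gluing c b" and idem: "ideal_prod (controlled M b) (controlled M b) = controlled M b"
    and A: "A \<in> controlled M b"
  shows "A \<in> entourages" "Id_on (Domain A) \<in> controlled M b" "Id_on (Range A) \<in> controlled M b"
proof -
  obtain B C where BC: "B \<in> controlled M b" "C \<in> controlled M b" "A \<subseteq> B O C"
    using A idem by (metis ideal_prodE)
  have "B O (C O A\<inverse>) \<in> controlled M b"
    using controlled_comp(1)[OF b BC(1)] controlled_comp_converse(1)[OF b BC(2) A] .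
  then show dom: "Id_on (Domain A) \<in> controlled M b"
    by (rule controlled_subset) (use BC(3) in blast)
  have "(A\<inverse> O B) O C \<in> controlled M b"
    using controlled_comp(2)[OF b BC(2)] controlled_comp_converse(2)[OF b A BC(1)] .
  then show "Id_on (Range A) \<in> controlled M b"
    by (rule controlled_subset) (use BC(3) in blast)
  \<comment> \<open>The diagonal over the domain, composed with \<open>A\<close>, is
    \<open>A\<close> itself.\<close>
  show "A \<in> entourages"
    using controlled_comp_converse(2)[OF b dom A] by (rule controlled_subset) auto
qed

text \<open>The midpoint of a pair in \<open>B O C\<close> lies in \<open>Range B\<close> and in
  \<open>Domain C\<close>. With the diagonals inserted there, the entourage \<open>B\<close> becomes
  controlled by \<open>b'\<close> and the entourage \<open>C\<close> by \<open>b\<close>.\<close>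

lemma idempotents_commute_le:
  assumes b: "gluing c b" "ideal_prod (controlled M b) (controlled M b) = controlled M b"
    and b': "gluing c' b'" "ideal_prod (controlled M b') (controlled M b') = controlled M b'"
  shows "ideal_prod (controlled M b) (controlled M b') \<subseteq> ideal_prod (controlled M b') (controlled M b)"
proof
  fix A assume "A \<in> ideal_prod (controlled M b) (controlled M b')"
  then obtain B C where BC: "B \<in> controlled M b" "C \<in> controlled M b'" "A \<subseteq> B O C"
    by (rule ideal_prodE)
  note B = idempotent_controlled[OF b BC(1)] and C = idempotent_controlled[OF b' BC(2)]
  show "A \<in> ideal_prod (controlled M b') (controlled M b)"
  proof (rule ideal_prodI)
    show "B O Id_on (Domain C) \<in> controlled M b'" by (rule controlled_comp(2)[OF b'(1) C(2) B(1)])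
    show "Id_on (Range B) O C \<in> controlled M b" by (rule controlled_comp(1)[OF b(1) B(3) C(1)])
    show "A \<subseteq> (B O Id_on (Domain C)) O Id_on (Range B) O C" using BC(3) by blast
  qed
qed

section \<open>The semigroup of coarse classes\<close>

definition coarse_class :: "'a double_dist \<Rightarrow> 'a double_dist set" where
  "coarse_class D = coarse_rel M d `` {D}"

lemma coarse_class_eq_iff:
  assumes "D1 \<in> double_metrics M d" "D2 \<in> double_metrics M d"
  shows "coarse_class D1 = coarse_class D2 \<longleftrightarrow> controlled M (cross D1) = controlled M (cross D2)"
proof -
  have mem: "D \<in> coarse_class D' \<longleftrightarrow>
      D \<in> double_metrics M d \<and> controlled M (cross D') = controlled M (cross D)"
    if "D' \<in> double_metrics M d" for D D'
    using coarse_rel_iff[OF that] unfolding coarse_class_def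
    by (auto simp: coarse_rel_def)
  show ?thesis using mem assms by (metis subsetI subset_antisym)
qed

lemma coarse_classes_iff:
  "s \<in> coarse_classes M d \<longleftrightarrow> (\<exists>D\<in>double_metrics M d. s = coarse_class D)"
  unfolding coarse_classes_def coarse_class_def quotient_def by blast

text \<open>The union over all representatives collapses to one class, because the family of a
  product depends only on the families of its factors.\<close>

lemma class_prod_coarse_class:
  assumes D1: "D1 \<in> double_metrics M d" and D2: "D2 \<in> double_metrics M d"
  shows "class_prod M d (coarse_class D1) (coarse_class D2) = coarse_class (metric_prod M d D1 D2)"
proof -
  have self: "D \<in> coarse_class D" if "D \<in> double_metrics M d" for D
    using coarse_rel_iff[OF that that] by (simp add: coarse_class_def)
  have "coarse_class (metric_prod M d D1' D2') = coarse_class (metric_prod M d D1 D2)"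
    if "D1' \<in> coarse_class D1" "D2' \<in> coarse_class D2" for D1' D2'
  proof -
    have D': "D1' \<in> double_metrics M d" "D2' \<in> double_metrics M d"
      using that by (auto simp: coarse_class_def coarse_rel_def)
    moreover have "controlled M (cross D1) = controlled M (cross D1')"
        "controlled M (cross D2) = controlled M (cross D2')"
      using that coarse_rel_iff[OF D1 D'(1)] coarse_rel_iff[OF D2 D'(2)]
      by (simp_all add: coarse_class_def)
    ultimately show ?thesis
      using D1 D2 by (simp add: coarse_class_eq_iff metric_prod_double_metrics controlled_metric_prod)
  qed
  then have "class_prod M d (coarse_class D1) (coarse_class D2) =
      (\<Union>D1'\<in>coarse_class D1. \<Union>D2'\<in>coarse_class D2. coarse_class (metric_prod M d D1 D2))"
    unfolding class_prod_def coarse_class_def[symmetric] by simp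
  then show ?thesis using self[OF D1] self[OF D2] by auto
qed

section \<open>Exchanging the copies: pseudoinverses and the inverse semigroup\<close>

definition flip_double :: "'a double_dist \<Rightarrow> 'a double_dist" where
  "flip_double D = double_of M d (\<lambda>x y. cross D y x)"

lemma
  assumes "D \<in> double_metrics M d"
  shows flip_double_metrics: "flip_double D \<in> double_metrics M d"
    and controlled_flip_double: "controlled M (cross (flip_double D)) = converse ` controlled M (cross D)"
proof -
  obtain c where c: "c > 0" "gluing c (cross D)" using assms by (rule gluing_cross)
  show "flip_double D \<in> double_metrics M d"
    unfolding flip_double_def by (rule double_of_double_metrics[OF c(1) gluing_flip[OF c(2)]])
  show "controlled M (cross (flip_double D)) = converse ` controlled M (cross D)"
    unfolding flip_double_def controlled_double_of by (rule controlled_flip)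
qed

lemma is_pseudoinverse_flip:
  assumes D: "D \<in> double_metrics M d"
  shows "is_pseudoinverse (coarse_classes M d) (class_prod M d)
    (coarse_class D) (coarse_class (flip_double D))"
proof -
  note F = flip_double_metrics[OF D]
  obtain c where g: "gluing c (cross D)" using D by (rule gluing_cross)
  obtain c' where g': "gluing c' (cross (flip_double D))" using F by (rule gluing_cross)
  have "converse ` controlled M (cross (flip_double D)) = controlled M (cross D)"
    by (simp add: controlled_flip_double[OF D] image_comp o_def)
  then have "class_prod M d (class_prod M d (coarse_class D) (coarse_class (flip_double D)))
        (coarse_class D) = coarse_class D"
      "class_prod M d (class_prod M d (coarse_class (flip_double D)) (coarse_class D))
        (coarse_class (flip_double D)) = coarse_class (flip_double D)"
    using controlled_regular[OF g] controlled_regular[OF g'] D F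
    by (simp_all add: class_prod_coarse_class metric_prod_double_metrics coarse_class_eq_iff
        controlled_metric_prod controlled_flip_double[OF D])
  then show ?thesis
    unfolding is_pseudoinverse_def coarse_classes_iff using F by blast
qed

lemma coarse_class_idempotent_iff:
  assumes "D \<in> double_metrics M d"
  shows "coarse_class D \<in> idempotents (coarse_classes M d) (class_prod M d) \<longleftrightarrow>
    ideal_prod (controlled M (cross D)) (controlled M (cross D)) = controlled M (cross D)"
  using assms by (auto simp: idempotents_def coarse_classes_iff class_prod_coarse_class
      metric_prod_double_metrics coarse_class_eq_iff controlled_metric_prod)

lemma inverse_semigroup_coarse_classes:
  "inverse_semigroup (coarse_classes M d) (class_prod M d)"
proof (rule inverse_semigroup_if_commuting_idempotents)
  fix a b assume "a \<in> coarse_classes M d" "b \<in> coarse_classes M d"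
  then show "class_prod M d a b \<in> coarse_classes M d"
    using class_prod_coarse_class metric_prod_double_metrics by (metis coarse_classes_iff)
next
  fix a b c assume "a \<in> coarse_classes M d" "b \<in> coarse_classes M d" "c \<in> coarse_classes M d"
  then show "class_prod M d (class_prod M d a b) c = class_prod M d a (class_prod M d b c)"
    unfolding coarse_classes_iff
    by (clarsimp simp: class_prod_coarse_class metric_prod_double_metrics coarse_class_eq_iff
        controlled_metric_prod ideal_prod_assoc)
next
  fix s assume "s \<in> coarse_classes M d"
  then show "\<exists>t. is_pseudoinverse (coarse_classes M d) (class_prod M d) s t"
    using is_pseudoinverse_flip by (metis coarse_classes_iff)
next
  fix e f
  assume e: "e \<in> idempotents (coarse_classes M d) (class_prod M d)"
    and f: "f \<in> idempotents (coarse_classes M d) (class_prod M d)"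
  obtain D1 where D1: "D1 \<in> double_metrics M d" "e = coarse_class D1"
    using e by (auto simp: idempotents_def coarse_classes_iff)
  obtain D2 where D2: "D2 \<in> double_metrics M d" "f = coarse_class D2"
    using f by (auto simp: idempotents_def coarse_classes_iff)
  obtain c1 where c1: "gluing c1 (cross D1)" using D1(1) by (rule gluing_cross)
  obtain c2 where c2: "gluing c2 (cross D2)" using D2(1) by (rule gluing_cross)
  note i1 = e[unfolded D1(2) coarse_class_idempotent_iff[OF D1(1)]]
  note i2 = f[unfolded D2(2) coarse_class_idempotent_iff[OF D2(1)]]
  have "ideal_prod (controlled M (cross D1)) (controlled M (cross D2)) =
      ideal_prod (controlled M (cross D2)) (controlled M (cross D1))"
    using idempotents_commute_le[OF c1 i1 c2 i2] idempotents_commute_le[OF c2 i2 c1 i1] by simp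
  then show "class_prod M d e f = class_prod M d f e"
    using D1 D2 by (simp add: class_prod_coarse_class metric_prod_double_metrics
        coarse_class_eq_iff controlled_metric_prod)
qed

section \<open>Separating coarse classes by idempotents of subsets\<close>

text \<open>The constant 1 keeps the copies apart; it sits in the second summand so that
  \<open>gluing_INF\<close> applies to \<open>d\<close> and \<open>d + 1\<close>.\<close>

definition set_double :: "'a set \<Rightarrow> 'a double_dist" where
  "set_double A = double_of M d (\<lambda>x y. INF a\<in>A. d x a + (d a y + 1))"

lemma
  assumes A: "A \<subseteq> M" "A \<noteq> {}"
  shows set_double_metrics: "set_double A \<in> double_metrics M d"
    and controlled_set_double: "G \<in> controlled M (cross (set_double A)) \<longleftrightarrow>
      (\<exists>B\<in>entourages. \<exists>C\<in>entourages. G \<subseteq> B O Id_on A O C)"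
proof -
  have g1: "gluing (0 + 1) (\<lambda>x y. d x y + 1)"
    using gluing_add[OF gluing_metric, of 1] by simp
  show "set_double A \<in> double_metrics M d"
    unfolding set_double_def
    by (rule double_of_double_metrics[OF _ gluing_INF[OF gluing_metric g1]]) (use A in auto)
  have "controlled M (\<lambda>x y. d x y + 1) = entourages"
  proof (intro equalityI; unfold controlled_subset_iff; intro allI)
    show "\<exists>S. \<forall>x\<in>M. \<forall>y\<in>M. d x y + 1 \<le> R \<longrightarrow> d x y \<le> S" for R
      by (rule exI[of _ R]) simp
    show "\<exists>S. \<forall>x\<in>M. \<forall>y\<in>M. d x y \<le> R \<longrightarrow> d x y + 1 \<le> S" for R
      by (rule exI[of _ "R + 1"]) simp
  qed
  then show "G \<in> controlled M (cross (set_double A)) \<longleftrightarrow>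
      (\<exists>B\<in>entourages. \<exists>C\<in>entourages. G \<subseteq> B O Id_on A O C)"
    unfolding set_double_def controlled_double_of
    using controlled_INF[OF gluing_metric g1 _ _ A(1)] A by simp
qed

lemma Id_on_entourage: "A \<subseteq> M \<Longrightarrow> Id_on A \<in> entourages"
  by (rule controlledI[where R = 0]) (auto simp: zero)

lemma set_double_idempotent:
  assumes A: "A \<subseteq> M" "A \<noteq> {}"
  shows "coarse_class (set_double A) \<in> idempotents (coarse_classes M d) (class_prod M d)"
proof -
  let ?I = "controlled M (cross (set_double A))"
  note mem = controlled_set_double[OF A]
  note comp = controlled_comp(1)[OF gluing_metric]
  have "ideal_prod ?I ?I = ?I"
  proof (intro set_eqI iffI)
    fix G assume "G \<in> ideal_prod ?I ?I"
    then obtain G1 G2 where "G1 \<in> ?I" "G2 \<in> ?I" and G: "G \<subseteq> G1 O G2"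
      by (rule ideal_prodE)
    then obtain B C B' C' where E: "B \<in> entourages" "C \<in> entourages" "B' \<in> entourages" "C' \<in> entourages"
      and sub: "G1 \<subseteq> B O Id_on A O C" "G2 \<subseteq> B' O Id_on A O C'"
      unfolding mem by blast
    \<comment> \<open>All that lies between the first diagonal of \<open>A\<close> and the end
      merges into one entourage.\<close>
    have "C O B' O Id_on A O C' \<in> entourages"
      using E comp Id_on_entourage[OF A(1)] by blast
    moreover have "G \<subseteq> B O Id_on A O (C O B' O Id_on A O C')"
      using G sub by blast
    ultimately show "G \<in> ?I" unfolding mem using E by blast
  next
    fix G assume "G \<in> ?I"
    then obtain B C where E: "B \<in> entourages" "C \<in> entourages" "G \<subseteq> B O Id_on A O C"
      unfolding mem by blast
    have "B O Id_on A O Id_on A \<in> ?I" "Id_on A O Id_on A O C \<in> ?I"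
      unfolding mem using E Id_on_entourage[OF A(1)] by blast+
    then show "G \<in> ideal_prod ?I ?I" by (rule ideal_prodI) (use E(3) in blast)
  qed
  then show ?thesis using coarse_class_idempotent_iff[OF set_double_metrics[OF A]] by simp
qed

text \<open>If \<open>y\<close> is bounded, then \<open>z k\<close> is as far from the whole range of \<open>y\<close> as it is from \<open>y k\<close>, up to
  a constant. Otherwise \<open>z\<close> is unbounded as well, and each new pair is chosen far from all earlier
  ones.\<close>

lemma ex_separating_subsequence:
  fixes y z :: "nat \<Rightarrow> 'a" and C :: real
  assumes yM: "\<And>n. y n \<in> M" and zM: "\<And>n. z n \<in> M"
    and far: "\<And>n. real n - C \<le> d (y n) (z n)"
    and near: "\<And>m n. d (y m) (y n) \<le> d (z m) (z n) + C"
  obtains f :: "nat \<Rightarrow> nat" and C' where "\<And>j k. real k - C' \<le> d (z (f k)) (y (f j))"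
proof (cases "\<exists>K. \<forall>n. d (y 0) (y n) \<le> K")
  case True
  then obtain K where K: "\<And>n. d (y 0) (y n) \<le> K" by blast
  \<comment> \<open>The whole sequence works: each of the detours from \<open>y k\<close> to
    \<open>y 0\<close> and from there to \<open>y j\<close> costs at most \<open>K\<close>.\<close>
  have "real k - (C + 2 * K) \<le> d (z k) (y j)" for k j
  proof -
    have "d (y k) (z k) \<le> d (y k) (y 0) + d (y 0) (y j) + d (y j) (z k)"
      using triangle[of "y k" "y 0" "z k"] triangle[of "y 0" "y j" "z k"] yM zM by simp
    then show ?thesis using far[of k] K[of k] K[of j] commute[of "y k"] commute[of "y j" "z k"] by simp
  qed
  then show ?thesis using that[of "C + 2 * K" id] by simp
next
  case False
  have unbounded: "\<exists>n\<ge>k. K < d (y 0) (y n)" for K and k :: nat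
  proof (rule ccontr)
    assume neg: "\<not> ?thesis"
    have "d (y 0) (y n) \<le> max K (\<Sum>i<k. d (y 0) (y i))" for n
    proof (cases "n < k")
      case True
      then have "d (y 0) (y n) \<le> (\<Sum>i<k. d (y 0) (y i))" by (intro member_le_sum) auto
      then show ?thesis by simp
    next
      case n: False
      then have "d (y 0) (y n) \<le> K" using neg by (meson not_le)
      then show ?thesis by simp
    qed
    with False show False by blast
  qed
  have escape: "\<exists>n\<ge>k. \<forall>p\<in>P. K \<le> d p (y n) \<and> K \<le> d p (z n)"
    if P: "finite P" "P \<subseteq> M" for P K and k :: nat
  proof -
    \<comment> \<open>A common bound for the distances from \<open>y 0\<close> and from
      \<open>z 0\<close> to \<open>P\<close>. If \<open>y n\<close> is far from \<open>y 0\<close>,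
      then by \<open>near\<close> also \<open>z n\<close> is far from \<open>z 0\<close>, so both
      are far from \<open>P\<close>.\<close>
    define L where "L = (\<Sum>p\<in>P. d (y 0) p + d (z 0) p)"
    have L: "d (y 0) p \<le> L" "d (z 0) p \<le> L" if "p \<in> P" for p
    proof -
      have "d (y 0) p + d (z 0) p \<le> L"
        unfolding L_def using P that by (intro member_le_sum) auto
      then show "d (y 0) p \<le> L" "d (z 0) p \<le> L"
        using nonneg[of "y 0" p] nonneg[of "z 0" p] by linarith+
    qed
    obtain n where n: "n \<ge> k" "K + L + \<bar>C\<bar> < d (y 0) (y n)"
      using unbounded by blast
    have "K \<le> d p (y n) \<and> K \<le> d p (z n)" if p: "p \<in> P" for p
    proof -
      have "p \<in> M" using p P by blast
      then show ?thesis
        using triangle[of "y 0" p "y n"] triangle[of "z 0" p "z n"] near[of 0 n] L[OF p] n(2) yM zM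
        by (smt (verit))
    qed
    then show ?thesis using n by blast
  qed
  \<comment> \<open>For \<open>j < k\<close> both mixed distances are fixed at stage
    \<open>k\<close>, since a pair with the larger index on \<open>y\<close> is settled only then.
    The condition \<open>k \<le> n\<close> settles equal indices through \<open>far\<close>.\<close>
  define Q where "Q f k n \<longleftrightarrow> k \<le> n \<and> (\<forall>j<k. real k \<le> d (z n) (y (f j)) \<and> real k \<le> d (z (f j)) (y n))"
    for f :: "nat \<Rightarrow> nat" and k n :: nat
  have "\<exists>f. \<forall>k. Q f k (f k)"
  proof (rule dependent_wellorder_choice)
    fix r :: nat and f g :: "nat \<Rightarrow> nat" and x :: nat
    assume "\<And>y. y < x \<Longrightarrow> f y = g y"
    then show "Q f x r = Q g x r" by (simp add: Q_def)
  next
    fix k :: nat and f :: "nat \<Rightarrow> nat"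
    have "(\<lambda>j. y (f j)) ` {..<k} \<union> (\<lambda>j. z (f j)) ` {..<k} \<subseteq> M" using yM zM by blast
    then obtain n where "n \<ge> k"
      "\<forall>p\<in>(\<lambda>j. y (f j)) ` {..<k} \<union> (\<lambda>j. z (f j)) ` {..<k}. real k \<le> d p (y n) \<and> real k \<le> d p (z n)"
      using escape[of "(\<lambda>j. y (f j)) ` {..<k} \<union> (\<lambda>j. z (f j)) ` {..<k}" k "real k"] by auto
    then show "\<exists>r. Q f k r" by (auto simp: Q_def commute intro!: exI[of _ n])
  qed
  then obtain f where f: "\<And>k. Q f k (f k)" by blast
  have "real k - \<bar>C\<bar> \<le> d (z (f k)) (y (f j))" for j k
  proof -
    consider "j < k" | "j = k" | "k < j" by linarith
    then show ?thesis
    proof cases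
      case 1
      then show ?thesis using f[of k] by (force simp: Q_def)
    next
      case 2
      then show ?thesis using far[of "f k"] f[of k] commute[of "y (f k)"] by (auto simp: Q_def)
    next
      case 3
      then have "real j \<le> d (z (f k)) (y (f j))" using f[of j] by (simp add: Q_def)
      then show ?thesis using 3 by simp
    qed
  qed
  then show ?thesis using that by blast
qed

text \<open>The hypothesis expresses that both classes act equally on the idempotents of nonempty
  subsets, the converse families being those of the pseudoinverses.\<close>

lemma controlled_le_if_conjugates_eq:
  assumes b: "gluing c b" and b': "gluing c' b'"
    and eq: "\<And>A. A \<subseteq> M \<Longrightarrow> A \<noteq> {} \<Longrightarrow>
      ideal_prod (ideal_prod (controlled M b) (controlled M (cross (set_double A)))) (converse ` controlled M b) =
      ideal_prod (ideal_prod (controlled M b') (controlled M (cross (set_double A)))) (converse ` controlled M b')"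
  shows "controlled M b \<subseteq> controlled M b'"
proof (rule ccontr)
  assume "\<not> ?thesis"
  then obtain G where G: "G \<in> controlled M b" "G \<notin> controlled M b'" by blast
  obtain R where R: "G \<subseteq> M \<times> M" "\<And>x y. (x, y) \<in> G \<Longrightarrow> b x y \<le> R"
    using G(1) unfolding controlled_def by blast
  have "\<exists>x y. (x, y) \<in> G \<and> real n < b' x y" for n :: nat
    using G(2) controlledI[OF R(1), of b' "real n"] by (meson not_le)
  then obtain x y where xy: "\<And>n. (x n, y n) \<in> G" "\<And>n. real n < b' (x n) (y n)"
    by metis
  have M: "x n \<in> M" "y n \<in> M" for n using xy(1)[of n] R by auto
  \<comment> \<open>The loops from \<open>x n\<close> to \<open>y n\<close> and back put the
    diagonal of \<open>x\<close>
    N\<open>into the conjugate under\<close>b\<open>, hence into the one under\<close>b'\<open>. So\<close>b'\<open>sends each\<close>x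
    n\<open>near\<close>y \<open>N\<close>, uniformly in \<open>n\<close>. This is used for all
    indices and for a subsequence.\<close>
  have image: "\<exists>S. \<forall>n\<in>N. \<exists>w\<in>M. \<exists>a\<in>y ` N. b' (x n) w \<le> S \<and> d w a \<le> S"
    if N: "N \<noteq> {}" for N
  proof -
    have A: "y ` N \<subseteq> M" "y ` N \<noteq> {}" using M N by auto
    have "Id_on (y ` N) O Id_on (y ` N) O Id_on (y ` N) \<in> controlled M (cross (set_double (y ` N)))"
      unfolding controlled_set_double[OF A] using Id_on_entourage[OF A(1)] by blast
    moreover have "Id_on (x ` N) \<subseteq> (G O Id_on (y ` N) O Id_on (y ` N) O Id_on (y ` N)) O G\<inverse>"
    proof
      fix p assume "p \<in> Id_on (x ` N)"
      then obtain n where n: "n \<in> N" "p = (x n, x n)" by auto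
      then have "(y n, y n) \<in> Id_on (y ` N)" by auto
      then show "p \<in> (G O Id_on (y ` N) O Id_on (y ` N) O Id_on (y ` N)) O G\<inverse>"
        unfolding n(2) using xy(1)[of n] by (meson converseI relcompI)
    qed
    ultimately have "Id_on (x ` N) \<in> ideal_prod (ideal_prod (controlled M b)
        (controlled M (cross (set_double (y ` N))))) (converse ` controlled M b)"
      using G(1) by (meson ideal_prodI image_eqI subset_refl)
    then obtain H K L where H: "H \<in> controlled M b'" and K: "K \<in> controlled M (cross (set_double (y ` N)))"
      and sub: "Id_on (x ` N) \<subseteq> H O K O L"
      unfolding eq[OF A] by (rule ideal_prod3E)
    obtain B C where B: "B \<in> entourages" and K': "K \<subseteq> B O Id_on (y ` N) O C"
      using K unfolding controlled_set_double[OF A] by blast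
    obtain S1 where S1: "H \<subseteq> M \<times> M" "\<And>x y. (x, y) \<in> H \<Longrightarrow> b' x y \<le> S1"
      using H unfolding controlled_def by blast
    obtain S2 where S2: "B \<subseteq> M \<times> M" "\<And>x y. (x, y) \<in> B \<Longrightarrow> d x y \<le> S2"
      using B unfolding controlled_def by blast
    have "\<exists>w\<in>M. \<exists>a\<in>y ` N. b' (x n) w \<le> max S1 S2 \<and> d w a \<le> max S1 S2" if n: "n \<in> N" for n
    proof -
      have "(x n, x n) \<in> H O K O L" using sub n by blast
      then obtain w a where "(x n, w) \<in> H" "(w, a) \<in> B" "a \<in> y ` N" using K' by blast
      then show ?thesis using S1 S2 by (meson SigmaD2 max.coboundedI1 max.coboundedI2 subsetD)
    qed
    then show ?thesis by blast
  qed
  obtain S z where z: "\<And>n. z n \<in> M" "\<And>n. b' (x n) (z n) \<le> S"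
    using image[of UNIV] by (metis UNIV_I UNIV_not_empty)
  \<comment> \<open>Large enough for both estimates below; the signs of \<open>R\<close> and
    \<open>S\<close> are unknown.\<close>
  define C where "C = 2 * \<bar>R\<bar> + 2 * \<bar>S\<bar>"
  have far: "real n - C \<le> d (y n) (z n)" for n
    using gluingD(3)[OF b', of "x n" "z n" "y n"] M[of n] z[of n] xy(2)[of n] commute[of "z n"]
    by (simp add: C_def)
  have near: "d (y m) (y n) \<le> d (z m) (z n) + C" for m n
  proof -
    have "d (y m) (y n) \<le> b (x m) (y m) + b (x m) (y n)"
      using gluingD(5)[OF b] M by blast
    also have "\<dots> \<le> b (x m) (y m) + (d (x m) (x n) + b (x n) (y n))"
      using gluingD(2)[OF b] M by simp
    also have "\<dots> \<le> 2 * R + d (x m) (x n)"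
      using R(2)[OF xy(1)[of m]] R(2)[OF xy(1)[of n]] by simp
    also have "d (x m) (x n) \<le> b' (x m) (z m) + b' (x n) (z m)"
      using gluingD(4)[OF b'] M z by blast
    also have "b' (x n) (z m) \<le> b' (x n) (z n) + d (z n) (z m)"
      using gluingD(3)[OF b'] M z by blast
    finally show ?thesis
      using z(2)[of m] z(2)[of n] commute[of "z n" "z m"] by (simp add: C_def)
  qed
  obtain f C' where f: "\<And>j k. real k - C' \<le> d (z (f k)) (y (f j))"
    using ex_separating_subsequence[of y z, OF M(2) z(1) far near] by blast
  obtain S' where S': "\<forall>n\<in>range f. \<exists>w\<in>M. \<exists>a\<in>y ` range f. b' (x n) w \<le> S' \<and> d w a \<le> S'"
    using image[of "range f"] by blast
  \<comment> \<open>Both \<open>w\<close> and \<open>z (f k)\<close> are at bounded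
    \<open>b'\<close>-distance from \<open>x (f k)\<close>, so they are near each other, and
    \<open>z (f k)\<close> is boundedly near the subsequence of \<open>y\<close>, against the choice
    of \<open>f\<close>.\<close>
  have "real k \<le> C' + S + 2 * S'" for k
  proof -
    obtain w j where w: "w \<in> M" "b' (x (f k)) w \<le> S'" "d w (y (f j)) \<le> S'"
      using S' by blast
    then have "d (z (f k)) (y (f j)) \<le> S + 2 * S'"
      using gluingD(5)[OF b', of "z (f k)" "x (f k)" w] triangle[of "z (f k)" w "y (f j)"]
        M z[of "f k"] by simp
    then show ?thesis using f[of k j] by simp
  qed
  then show False by (meson not_le reals_Archimedean2)
qed

lemma conj_action_coarse_class:
  assumes D: "D \<in> double_metrics M d" and E: "E \<in> double_metrics M d"
  shows "conj_action (coarse_classes M d) (class_prod M d) (coarse_class D) (coarse_class E) =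
    coarse_class (metric_prod M d (metric_prod M d D E) (flip_double D))"
proof -
  have "pseudoinverse (coarse_classes M d) (class_prod M d) (coarse_class D) = coarse_class (flip_double D)"
    using inverse_semigroup_coarse_classes _ is_pseudoinverse_flip[OF D]
    by (rule pseudoinverse_eq) (use D coarse_classes_iff in blast)
  then show ?thesis
    using D E by (simp add: conj_action_def class_prod_coarse_class metric_prod_double_metrics
        flip_double_metrics)
qed

lemma fundamental_coarse_classes: "fundamental (coarse_classes M d) (class_prod M d)"
  unfolding fundamental_def
proof (intro ballI impI)
  fix s t assume s: "s \<in> coarse_classes M d" and t: "t \<in> coarse_classes M d" and "s \<noteq> t"
  obtain D1 where D1: "D1 \<in> double_metrics M d" "s = coarse_class D1"
    using s coarse_classes_iff by blast
  obtain D2 where D2: "D2 \<in> double_metrics M d" "t = coarse_class D2"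
    using t coarse_classes_iff by blast
  obtain c1 where c1: "gluing c1 (cross D1)" using D1(1) by (rule gluing_cross)
  obtain c2 where c2: "gluing c2 (cross D2)" using D2(1) by (rule gluing_cross)
  show "\<exists>e\<in>idempotents (coarse_classes M d) (class_prod M d).
      conj_action (coarse_classes M d) (class_prod M d) s e \<noteq>
      conj_action (coarse_classes M d) (class_prod M d) t e"
  proof (rule ccontr)
    assume neg: "\<not> ?thesis"
    have eq: "ideal_prod (ideal_prod (controlled M (cross D1)) (controlled M (cross (set_double A))))
          (converse ` controlled M (cross D1)) =
        ideal_prod (ideal_prod (controlled M (cross D2)) (controlled M (cross (set_double A))))
          (converse ` controlled M (cross D2))"
      if A: "A \<subseteq> M" "A \<noteq> {}" for A
    proof -
      have "conj_action (coarse_classes M d) (class_prod M d) s (coarse_class (set_double A)) =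
          conj_action (coarse_classes M d) (class_prod M d) t (coarse_class (set_double A))"
        using neg set_double_idempotent[OF A] by blast
      then show ?thesis
        using D1 D2 set_double_metrics[OF A]
        by (simp add: conj_action_coarse_class coarse_class_eq_iff metric_prod_double_metrics
            flip_double_metrics controlled_metric_prod controlled_flip_double)
    qed
    \<comment> \<open>Agreement on the idempotents of subsets is symmetric in the two metrics, so it
      yields both inclusions.\<close>
    have "controlled M (cross D1) = controlled M (cross D2)"
      using controlled_le_if_conjugates_eq[OF c1 c2 eq]
        controlled_le_if_conjugates_eq[OF c2 c1 eq[symmetric]] by blast
    with \<open>s \<noteq> t\<close> D1 D2 show False by (simp add: coarse_class_eq_iff)
  qed
qed

end

theorem theorem4:
  fixes M :: "'a set" and d :: "'a \<Rightarrow> 'a \<Rightarrow> real"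
  assumes "Metric_space M d"
  shows "inverse_semigroup (coarse_classes M d) (class_prod M d) \<and>
    fundamental (coarse_classes M d) (class_prod M d)"
  using Metric_space.inverse_semigroup_coarse_classes[OF assms]
    Metric_space.fundamental_coarse_classes[OF assms] by blast

end
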